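(* Let $0<\alpha<1$, $b>0$, $T>1$, and integers $K\ge1$, $N_b\ge1$, $s\ge 1$. Let $H=b/K$, $h=H/2$, $x_k=kH$ for $0\le k\le K$, $I_k=[x_{k-1},x_k]$ and $c_k=\frac{x_{k-1}+x_k}2$ for $1\le k\le K$. Let $c_{k,j}\in\mathbb R$ ($1\le k\le K$, $0\le j\le N_b-1$) be local frame coefficients, and let $D^\alpha_{N_b,\eta}f$ be the associated Caputo approximation defined in the context. Let $0<\rho_\mu\le1$ ($\mu=1,\dots,s$), $\theta_\mu=2\rho_\mu-1$, $x_{k,\mu}=x_{k-1}+\rho_\mu H$, and $\lambda_{d,\mu}=2d+2\rho_\mu-1$. Define $$B_{\mu,j}^{(\alpha)}=\frac{h^{-\alpha}}{\Gamma(1-\alpha)}\int_{-1}^{\theta_\mu}(\theta_\mu-t)^{-\alpha}\bigl(P_j^{(T)}\bigr)'(t)\,dt,\qquad A_{d,\mu,j}^{(\alpha)}=\frac{h^{-\alpha}}{\Gamma(1-\alpha)}\int_{-1}^{1}(\lambda_{d,\mu}-t)^{-\alpha}\bigl(P_j^{(T)}\bigr)'(t)\,dt$$ for $d=1,\dots,K-1$. Then for all $1\le k\le K$ and $1\le\mu\le s$, $$D_{N_b,\eta}^{\alpha}f(x_{k,\mu})=\sum_{j=0}^{N_b-1}B_{\mu,j}^{(\alpha)}c_{k,j}+\sum_{d=1}^{k-1}\sum_{j=0}^{N_b-1}A_{d,\mu,j}^{(\alpha)}c_{k-d,j}.$$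
   Context: $P_j^{(T)}(t)=T^{-1/2}p_j(t/T)$, where $\{p_j\}_{j\ge0}$ are the orthonormal Legendre polynomials on $[-1,1]$. The coefficients $c_{k,j}$ define the local approximation $\sum_{j=0}^{N_b-1}c_{k,j}P_j^{(T)}\bigl((x-c_k)/h\bigr)$ of a function $f$ on $I_k$, whose piecewise derivative is $$q(x)=\frac1h\sum_{j=0}^{N_b-1}c_{k,j}\bigl(P_j^{(T)}\bigr)'\!\left(\frac{x-c_k}{h}\right),\qquad x\in I_k$$ (values at the partition points are immaterial). The Caputo approximation is $$D_{N_b,\eta}^{\alpha}f(x)=\frac1{\Gamma(1-\alpha)}\int_0^x(x-\xi)^{-\alpha}q(\xi)\,d\xi,\qquad x\in(0,b].$$ (In the method the $c_{k,j}$ are computed from samples of $f$ by a regularized least-squares fit with truncation threshold $\eta$; the identity concerns only the action of the integral on given coefficients.) *)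

theory Defs
  imports "HOL-Analysis.Analysis" "HOL-Computational_Algebra.Polynomial"
begin

text \<open>Legendre polynomials by Rodrigues' formula; the factor \<open>sqrt ((2 j + 1) / 2)\<close>
  makes them orthonormal in \<open>L\<^sup>2\<close> of \<open>[-1, 1]\<close>.\<close>

definition legendre_poly :: "nat \<Rightarrow> real poly" where
  "legendre_poly j = smult (1 / (2 ^ j * fact j)) ((pderiv ^^ j) ([:-1, 0, 1:] ^ j))"

definition orthonormal_legendre :: "nat \<Rightarrow> real poly" where
  "orthonormal_legendre j = smult (sqrt ((2 * real j + 1) / 2)) (legendre_poly j)"

definition frame_fun :: "real \<Rightarrow> nat \<Rightarrow> real \<Rightarrow> real" where
  "frame_fun T j t = T powr (- 1 / 2) * poly (orthonormal_legendre j) (t / T)"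

definition subinterval_length :: "real \<Rightarrow> nat \<Rightarrow> real" where
  "subinterval_length b K = b / real K"

definition half_length :: "real \<Rightarrow> nat \<Rightarrow> real" where
  "half_length b K = subinterval_length b K / 2"

definition node :: "real \<Rightarrow> nat \<Rightarrow> nat \<Rightarrow> real" where
  "node b K k = real k * subinterval_length b K"

definition center :: "real \<Rightarrow> nat \<Rightarrow> nat \<Rightarrow> real" where
  "center b K k = (node b K (k - 1) + node b K k) / 2"

text \<open>The values of \<open>q\<close> at the partition points are left unconstrained.
  The first index of the coefficients \<open>c\<close> is the subinterval, the second the frame function.\<close>

definition is_piecewise_derivative ::
  "real \<Rightarrow> real \<Rightarrow> nat \<Rightarrow> nat \<Rightarrow> (nat \<Rightarrow> nat \<Rightarrow> real) \<Rightarrow> (real \<Rightarrow> real) \<Rightarrow> bool" where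
  "is_piecewise_derivative T b K Nb c q \<longleftrightarrow>
     (\<forall>k\<in>{1..K}. \<forall>x\<in>{node b K (k - 1)<..<node b K k}.
        q x = 1 / half_length b K *
          (\<Sum>j<Nb. c k j * deriv (frame_fun T j) ((x - center b K k) / half_length b K)))"

text \<open>In the integrals below, \<open>0 powr (- \<alpha>) = 0\<close> affects the integrand at one point only.\<close>

definition caputo_approx :: "real \<Rightarrow> (real \<Rightarrow> real) \<Rightarrow> real \<Rightarrow> real" where
  "caputo_approx \<alpha> q x =
     1 / Gamma (1 - \<alpha>) * integral {0..x} (\<lambda>\<xi>. (x - \<xi>) powr (- \<alpha>) * q \<xi>)"

definition B_coeff ::
  "real \<Rightarrow> real \<Rightarrow> real \<Rightarrow> nat \<Rightarrow> (nat \<Rightarrow> real) \<Rightarrow> nat \<Rightarrow> nat \<Rightarrow> real" where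
  "B_coeff \<alpha> T b K \<rho> \<mu> j = half_length b K powr (- \<alpha>) / Gamma (1 - \<alpha>) *
     (let \<theta> = 2 * \<rho> \<mu> - 1 in
      integral {-1..\<theta>} (\<lambda>t. (\<theta> - t) powr (- \<alpha>) * deriv (frame_fun T j) t))"

definition A_coeff ::
  "real \<Rightarrow> real \<Rightarrow> real \<Rightarrow> nat \<Rightarrow> (nat \<Rightarrow> real) \<Rightarrow> nat \<Rightarrow> nat \<Rightarrow> nat \<Rightarrow> real" where
  "A_coeff \<alpha> T b K \<rho> d \<mu> j = half_length b K powr (- \<alpha>) / Gamma (1 - \<alpha>) *
     (let lam = 2 * real d + 2 * \<rho> \<mu> - 1 in
      integral {-1..1} (\<lambda>t. (lam - t) powr (- \<alpha>) * deriv (frame_fun T j) t))"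

end

theory Submission
  imports Defs
begin

text \<open>Split \<open>[0, x\<^sub>k\<^sub>,\<^sub>\<mu>]\<close> at the nodes and map each subinterval to the reference interval by
  \<open>\<xi> = c\<^sub>m + h t\<close>.  The kernel scales by \<open>h powr - \<alpha>\<close>, the Jacobian cancels the factor \<open>1 / h\<close>
  of \<open>q\<close>, and \<open>x\<^sub>k\<^sub>,\<^sub>\<mu>\<close> becomes \<open>2 d + 2 \<rho>\<^sub>\<mu> - 1\<close> with \<open>d = k - m\<close>; uniformity of the mesh is what
  makes this depend on \<open>d\<close> only.\<close>

lemma continuous_on_deriv_frame_fun: "continuous_on S (deriv (frame_fun T j))"
proof -
  have "(frame_fun T j has_field_derivative
      T powr (- 1 / 2) * (poly (pderiv (orthonormal_legendre j)) (t / T) * (1 / T))) (at t)" for t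
    unfolding frame_fun_def
    by (intro DERIV_cmult DERIV_chain2[OF poly_DERIV] DERIV_cdivide DERIV_ident)
  then have "deriv (frame_fun T j) =
      (\<lambda>t. T powr (- 1 / 2) * (poly (pderiv (orthonormal_legendre j)) (t / T) * (1 / T)))"
    by (intro ext DERIV_imp_deriv)
  then show ?thesis
    \<comment> \<open>Nothing is assumed about \<open>T\<close>: since \<open>t / 0 = 0\<close>, the
      formula also covers \<open>T = 0\<close>, where the derivative is constantly 0.\<close>
    by (cases "T = 0") (simp_all, intro continuous_intros, simp_all)
qed

text \<open>As \<open>- \<alpha> > -1\<close>, the kernel has a finite integral up to its
  singularity \<open>v\<close>. Being nonnegative, it is absolutely integrable, and this survives
  multiplication by \<open>g\<close>, bounded on the compact interval. The singularity may sit at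
  the end (\<open>u = v\<close>) or beyond it.\<close>

lemma weakly_singular_integrable:
  fixes g :: "real \<Rightarrow> real"
  assumes "\<alpha> < 1" "u \<le> v" and g: "continuous_on {a..u} g"
  shows "(\<lambda>t. (v - t) powr (- \<alpha>) * g t) integrable_on {a..u}"
proof (cases "a \<le> u")
  case True
  \<comment> \<open>The reflection \<open>x = v - t\<close> moves the singularity to 0.\<close>
  have "((\<lambda>x. x powr (- \<alpha>)) has_integral ((v - a) powr (- \<alpha> + 1) / (- \<alpha> + 1))) (cbox 0 (v - a))"
    using has_integral_powr_from_0[of "- \<alpha>" "v - a"] assms True by simp
  from has_integral_affinity[OF this, of "-1" v]
  have "(\<lambda>t. (v - t) powr (- \<alpha>)) integrable_on ((\<lambda>x. - x + v) ` {0..v - a})"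
    by (auto simp: integrable_on_def)
  moreover have "(\<lambda>x. - x + v) ` {0..v - a} = {a..v}"
    using image_affinity_atLeastAtMost[of "-1" v 0 "v - a"] assms True by simp
  ultimately have "(\<lambda>t. (v - t) powr (- \<alpha>)) integrable_on {a..v}" by simp
  then have "(\<lambda>t. (v - t) powr (- \<alpha>)) integrable_on {a..u}"
    by (rule integrable_on_subinterval) (use assms in auto)
  then have kernel: "(\<lambda>t. (v - t) powr (- \<alpha>)) absolutely_integrable_on {a..u}"
    by (intro nonnegative_absolutely_integrable_1) auto
  have "(\<lambda>t. g t * (v - t) powr (- \<alpha>)) absolutely_integrable_on {a..u}"
  proof (rule absolutely_integrable_bounded_measurable_product_real[OF _ _ _ kernel])
    show "g \<in> borel_measurable (lebesgue_on {a..u})"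
      by (intro continuous_imp_measurable_on_sets_lebesgue g) auto
    show "bounded (g ` {a..u})"
      using compact_continuous_image[OF g] compact_imp_bounded by blast
  qed auto
  then show ?thesis
    by (simp add: mult.commute set_lebesgue_integral_eq_integral(1))
qed auto

text \<open>Keeping the upper limit \<open>u\<close> apart from the singularity \<open>v\<close>
  lets one change of variables serve both coefficient families: \<open>u = v = \<theta>\<close> for
  the subinterval containing the evaluation point, \<open>u = 1 \<le> v\<close> for the earlier
  ones.\<close>

lemma has_integral_kernel_piece:
  assumes pd: "is_piecewise_derivative T b K Nb c q"
    and "\<alpha> < 1" "b > 0" "m \<in> {1..K}" "u \<le> v" "- 1 < u" "u \<le> 1"
  defines "h \<equiv> half_length b K"
  shows "((\<lambda>\<xi>. (center b K m + h * v - \<xi>) powr (- \<alpha>) * q \<xi>) has_integral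
     (\<Sum>j<Nb. h powr (- \<alpha>) * integral {-1..u} (\<lambda>t. (v - t) powr (- \<alpha>) * deriv (frame_fun T j) t)
       * c m j)) {node b K (m - 1)..center b K m + h * u}"
proof -
  let ?C = "center b K m" and ?D = "\<lambda>j. deriv (frame_fun T j)"
  let ?I = "\<lambda>j. integral {-1..u} (\<lambda>t. (v - t) powr (- \<alpha>) * ?D j t)"
  define F where "F = (\<lambda>t. \<Sum>j<Nb. (v - t) powr (- \<alpha>) * ?D j t * c m j)"
  have h: "h > 0"
    using assms by (simp add: h_def half_length_def subinterval_length_def)
  have left: "node b K (m - 1) = ?C - h" and right: "node b K m = ?C + h"
    using \<open>m \<in> {1..K}\<close>
    by (auto simp: center_def node_def h_def half_length_def of_nat_diff field_simps)
  have "(F has_integral (\<Sum>j<Nb. ?I j * c m j)) {-1..u}"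
    unfolding F_def
    by (intro has_integral_sum has_integral_mult_left integrable_integral
        weakly_singular_integrable continuous_on_deriv_frame_fun) (use assms in auto)
  then have "((\<lambda>\<xi>. F ((1 / h) * \<xi> + - (?C / h))) has_integral (h * (\<Sum>j<Nb. ?I j * c m j)))
      ((\<lambda>x. h * x + ?C) ` {-1..u})"
    using has_integral_affinity[of F _ "-1" u "1 / h" "- (?C / h)"] h by simp
  moreover have "(\<lambda>x. h * x + ?C) ` {-1..u} = {?C - h..?C + h * u}"
    using image_affinity_atLeastAtMost[of h ?C "-1" u] h assms by (simp add: add.commute)
  \<comment> \<open>The factor combines the scaling of the kernel with the \<open>1 / h\<close> in
    \<open>q\<close>; the latter cancels the Jacobian \<open>h\<close>.\<close>
  ultimately have "((\<lambda>\<xi>. h powr (- \<alpha>) / h * F ((1 / h) * \<xi> + - (?C / h))) has_integral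
      (h powr (- \<alpha>) / h * (h * (\<Sum>j<Nb. ?I j * c m j)))) {?C - h..?C + h * u}"
    by (intro has_integral_mult_right) simp
  then have "((\<lambda>\<xi>. (?C + h * v - \<xi>) powr (- \<alpha>) * q \<xi>) has_integral
      (h powr (- \<alpha>) / h * (h * (\<Sum>j<Nb. ?I j * c m j)))) {?C - h..?C + h * u}"
  \<comment> \<open>\<open>q\<close> is prescribed only inside the subinterval, so the integrands
    are compared away from the two endpoints; there also \<open>t < v\<close>.\<close>
  proof (rule has_integral_spike_finite[rotated 2])
    show "finite {?C - h, ?C + h * u}" by simp
    fix \<xi> assume "\<xi> \<in> {?C - h..?C + h * u} - {?C - h, ?C + h * u}"
    then have \<xi>: "?C - h < \<xi>" "\<xi> < ?C + h * u" by auto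
    define t where "t = (\<xi> - ?C) / h"
    have \<xi>_eq: "\<xi> = ?C + h * t" and t: "(1 / h) * \<xi> + - (?C / h) = t"
      using h by (auto simp: t_def field_simps)
    have "t < u" using \<xi>(2) h unfolding \<xi>_eq by simp
    then have "t < v" using assms by simp
    have "h * u \<le> h" using h assms by simp
    then have "\<xi> < ?C + h" using \<xi> by simp
    then have q: "q \<xi> = 1 / h * (\<Sum>j<Nb. c m j * ?D j t)"
      using pd \<open>m \<in> {1..K}\<close> \<xi> left right
      unfolding is_piecewise_derivative_def t_def h_def by auto
    have "?C + h * v - \<xi> = h * (v - t)" by (simp add: \<xi>_eq algebra_simps)
    then have "(?C + h * v - \<xi>) powr (- \<alpha>) = h powr (- \<alpha>) * (v - t) powr (- \<alpha>)"
      using h \<open>t < v\<close> by (simp add: powr_mult)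
    then show "(?C + h * v - \<xi>) powr (- \<alpha>) * q \<xi> =
        h powr (- \<alpha>) / h * F ((1 / h) * \<xi> + - (?C / h))"
      unfolding t q F_def by (simp add: sum_distrib_left sum_divide_distrib mult_ac)
  qed
  then show ?thesis
    using h by (simp add: left[simplified] sum_distrib_left mult_ac)
qed

text \<open>Induction on adjacent pieces. The degenerate case \<open>n = 0\<close> is the empty
  history sum at \<open>k = 1\<close>.\<close>

lemma has_integral_node_sum:
  fixes f :: "real \<Rightarrow> 'a::banach"
  assumes "b > 0"
    and "\<And>m. m \<in> {1..n} \<Longrightarrow> (f has_integral G m) {node b K (m - 1)..node b K m}"
  shows "(f has_integral (\<Sum>m\<in>{1..n}. G m)) {0..node b K n}"
  using assms(2)
proof (induction n)
  case 0
  then show ?case using has_integral_refl(2)[of f 0] by (simp add: node_def)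
next
  case (Suc n)
  have init: "(f has_integral (\<Sum>m\<in>{1..n}. G m)) {0..node b K n}"
    by (rule Suc.IH) (use Suc.prems in auto)
  have last: "(f has_integral G (Suc n)) {node b K n..node b K (Suc n)}"
    using Suc.prems[of "Suc n"] by simp
  have "0 \<le> node b K n" "node b K n \<le> node b K (Suc n)"
    using \<open>b > 0\<close> by (auto simp: node_def subinterval_length_def intro!: divide_right_mono mult_right_mono)
  from has_integral_combine[OF this init last] show ?case by simp
qed

theorem mainTheorem6:
  fixes \<alpha> b T :: real and K Nb s :: nat
    and c :: "nat \<Rightarrow> nat \<Rightarrow> real" and q :: "real \<Rightarrow> real" and \<rho> :: "nat \<Rightarrow> real"
  assumes "0 < \<alpha>" "\<alpha> < 1" "b > 0" "T > 1"
    and "K \<ge> 1" "Nb \<ge> 1" "s \<ge> 1"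
    and "is_piecewise_derivative T b K Nb c q"
    and "\<forall>\<mu>\<in>{1..s}. 0 < \<rho> \<mu> \<and> \<rho> \<mu> \<le> 1"
  shows "\<forall>k\<in>{1..K}. \<forall>\<mu>\<in>{1..s}.
    caputo_approx \<alpha> q (node b K (k - 1) + \<rho> \<mu> * subinterval_length b K) =
      (\<Sum>j<Nb. B_coeff \<alpha> T b K \<rho> \<mu> j * c k j) +
      (\<Sum>d\<in>{1..<k}. \<Sum>j<Nb. A_coeff \<alpha> T b K \<rho> d \<mu> j * c (k - d) j)"
proof (intro ballI)
  fix k \<mu> assume k: "k \<in> {1..K}" and "\<mu> \<in> {1..s}"
  then have \<rho>: "0 < \<rho> \<mu>" "\<rho> \<mu> \<le> 1" using assms by auto
  let ?X = "node b K (k - 1) + \<rho> \<mu> * subinterval_length b K" and ?h = "half_length b K"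
  let ?f = "\<lambda>\<xi>. (?X - \<xi>) powr (- \<alpha>) * q \<xi>"
  \<comment> \<open>Up to the factor \<open>1 / Gamma (1 - \<alpha>)\<close>,
    \<open>I \<theta> \<theta>\<close> is the B coefficient and \<open>I 1 (lam d)\<close> the A
    coefficient.\<close>
  define I where "I = (\<lambda>u v j. ?h powr (- \<alpha>) *
    integral {-1..u} (\<lambda>t. (v - t) powr (- \<alpha>) * deriv (frame_fun T j) t))"
  define \<theta> where "\<theta> = 2 * \<rho> \<mu> - 1"
  define lam where "lam = (\<lambda>d. 2 * real d + 2 * \<rho> \<mu> - 1)"
  \<comment> \<open>In units of \<open>?h\<close>, the centers of subintervals \<open>m\<close> and
    \<open>k\<close> are \<open>2 * (k - m)\<close> apart, and the point lies at
    \<open>2 * \<rho> \<mu> - 1\<close> from the latter.\<close>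
  have X: "?X = center b K m + ?h * lam (k - m)" if "m \<in> {1..k}" for m
    using that k
    by (auto simp: center_def node_def half_length_def lam_def of_nat_diff field_simps)
  have full: "(?f has_integral (\<Sum>j<Nb. I 1 (lam (k - m)) j * c m j))
      {node b K (m - 1)..node b K m}" if "m \<in> {1..k - 1}" for m
  proof -
    have m: "m \<in> {1..k}" "m \<in> {1..K}" "1 \<le> k - m" using that k by auto
    then have "1 \<le> real (k - m)" by simp
    then have "1 \<le> lam (k - m)" using \<rho> unfolding lam_def by linarith
    moreover have "center b K m + ?h * 1 = node b K m"
      using that by (auto simp: center_def node_def half_length_def of_nat_diff field_simps)
    ultimately show ?thesis
      using has_integral_kernel_piece[of T b K Nb c q \<alpha> m 1 "lam (k - m)"] X[OF m(1)] m assms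
      unfolding I_def by simp
  qed
  have init: "(?f has_integral (\<Sum>m\<in>{1..k - 1}. \<Sum>j<Nb. I 1 (lam (k - m)) j * c m j))
      {0..node b K (k - 1)}"
    by (rule has_integral_node_sum[OF \<open>b > 0\<close> full])
  have "lam (k - k) = \<theta>" by (simp add: lam_def \<theta>_def)
  then have last: "(?f has_integral (\<Sum>j<Nb. I \<theta> \<theta> j * c k j)) {node b K (k - 1)..?X}"
    using has_integral_kernel_piece[of T b K Nb c q \<alpha> k \<theta> \<theta>] X[of k] k assms \<rho>
    unfolding I_def by (simp add: \<theta>_def)
  have "0 \<le> node b K (k - 1)" "node b K (k - 1) \<le> ?X"
    using \<open>b > 0\<close> \<rho> by (auto simp: node_def subinterval_length_def)
  from has_integral_combine[OF this init last] have "integral {0..?X} ?f =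
      (\<Sum>m\<in>{1..k - 1}. \<Sum>j<Nb. I 1 (lam (k - m)) j * c m j) + (\<Sum>j<Nb. I \<theta> \<theta> j * c k j)"
    by (rule integral_unique)
  also have "(\<Sum>m\<in>{1..k - 1}. \<Sum>j<Nb. I 1 (lam (k - m)) j * c m j) =
      (\<Sum>d\<in>{1..<k}. \<Sum>j<Nb. I 1 (lam d) j * c (k - d) j)"
    \<comment> \<open>Passing from position \<open>m\<close> to lag \<open>d = k - m\<close>
      reverses the order of the history sum.\<close>
    by (rule sum.reindex_bij_witness[of _ "\<lambda>d. k - d" "\<lambda>m. k - m"]) auto
  finally show "caputo_approx \<alpha> q ?X =
      (\<Sum>j<Nb. B_coeff \<alpha> T b K \<rho> \<mu> j * c k j) +
      (\<Sum>d\<in>{1..<k}. \<Sum>j<Nb. A_coeff \<alpha> T b K \<rho> d \<mu> j * c (k - d) j)"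
    unfolding caputo_approx_def B_coeff_def A_coeff_def I_def lam_def \<theta>_def Let_def
    by (simp add: add_divide_distrib sum_divide_distrib)
qed

end
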